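(* Let $F:\mathcal{C}\to\mathcal{D}$ and $H:\mathcal{C}\to\mathcal{E}$ be functors. If $F$ is $H$-separable, then $F$ is both an $H$-Maschke functor and a dual $H$-Maschke functor.
   Context: For functors $F:\mathcal{C}\to\mathcal{D}$ and $H:\mathcal{C}\to\mathcal{E}$: - $F$ is $H$-separable if there is a family of maps $\mathcal{P}_{C,C'}:\mathrm{Hom}_{\mathcal{D}}(F(C),F(C'))\to\mathrm{Hom}_{\mathcal{E}}(H(C),H(C'))$, natural in $C,C'$ (i.e. $\mathcal{P}_{X,T}(F(v)\circ h\circ F(u))=H(v)\circ\mathcal{P}_{Y,Z}(h)\circ H(u)$ for all $u:X\to Y$, $v:Z\to T$ in $\mathcal{C}$ and $h:F(Y)\to F(Z)$ in $\mathcal{D}$), with $\mathcal{P}_{C,C'}(F(f))=H(f)$ for all $f:C\to C'$ in $\mathcal{C}$. - $M\in\mathcal{C}$ is $F$-relative $H$-injective if for every $i:C\to C'$ in $\mathcal{C}$ such that $F(i)$ has a left inverse in $\mathcal{D}$, and every $f:C\to M$ in $\mathcal{C}$, there is $g:H(C')\to H(M)$ in $\mathcal{E}$ with $H(f)=g\circ H(i)$. $F$ is $H$-Maschke if every object of $\mathcal{C}$ is $F$-relative $H$-injective. - Dually, $P\in\mathcal{C}$ is $F$-relative $H$-projective if for every $p:C'\to C$ in $\mathcal{C}$ such that $F(p)$ has a right inverse in $\mathcal{D}$, and every $f:P\to C$, there is $g:H(P)\to H(C')$ in $\mathcal{E}$ with $H(f)=H(p)\circ g$. $F$ is dual $H$-Maschke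 if every object of $\mathcal{C}$ is $F$-relative $H$-projective. *)

theory Defs
  imports Main
begin

text \<open>
  Objects and morphisms are carved out of arbitrary HOL types. Every morphism has a unique
  domain and codomain, so hom-sets are pairwise disjoint. The values of the operations outside
  \<open>Obj\<close> and \<open>Arr\<close>, or on non-composable pairs, are unconstrained.
\<close>

record ('o, 'm) category =
  Obj :: "'o set"
  Arr :: "'m set"
  Dom :: "'m \<Rightarrow> 'o"
  Cod :: "'m \<Rightarrow> 'o"
  Id :: "'o \<Rightarrow> 'm"
  Comp :: "'m \<Rightarrow> 'm \<Rightarrow> 'm"  (infixr "\<cdot>\<index>" 70)

definition Hom :: "('o, 'm, 'x) category_scheme \<Rightarrow> 'o \<Rightarrow> 'o \<Rightarrow> 'm set" where
  "Hom C X Y = {f \<in> Arr C. Dom C f = X \<and> Cod C f = Y}"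

locale category =
  fixes C :: "('o, 'm, 'x) category_scheme" (structure)
  assumes dom_in_Obj: "f \<in> Arr C \<Longrightarrow> Dom C f \<in> Obj C"
    and cod_in_Obj: "f \<in> Arr C \<Longrightarrow> Cod C f \<in> Obj C"
    and id_in_Hom: "X \<in> Obj C \<Longrightarrow> Id C X \<in> Hom C X X"
    and comp_in_Hom: "\<lbrakk>f \<in> Hom C X Y; g \<in> Hom C Y Z\<rbrakk> \<Longrightarrow> g \<cdot> f \<in> Hom C X Z"
    and comp_id_right: "f \<in> Hom C X Y \<Longrightarrow> f \<cdot> Id C X = f"
    and comp_id_left: "f \<in> Hom C X Y \<Longrightarrow> Id C Y \<cdot> f = f"
    and comp_assoc:
      "\<lbrakk>f \<in> Hom C X Y; g \<in> Hom C Y Z; h \<in> Hom C Z T\<rbrakk> \<Longrightarrow> (h \<cdot> g) \<cdot> f = h \<cdot> (g \<cdot> f)"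

record ('o1, 'm1, 'o2, 'm2) functor_map =
  omap :: "'o1 \<Rightarrow> 'o2"
  amap :: "'m1 \<Rightarrow> 'm2"

locale cat_functor = source: category C + target: category D
  for C :: "('o1, 'm1, 'x1) category_scheme"
    and D :: "('o2, 'm2, 'x2) category_scheme" +
  fixes F :: "('o1, 'm1, 'o2, 'm2, 'y) functor_map_scheme"
  assumes omap_in_Obj: "X \<in> Obj C \<Longrightarrow> omap F X \<in> Obj D"
    and amap_in_Hom: "f \<in> Hom C X Y \<Longrightarrow> amap F f \<in> Hom D (omap F X) (omap F Y)"
    and amap_id: "X \<in> Obj C \<Longrightarrow> amap F (Id C X) = Id D (omap F X)"
    and amap_comp:
      "\<lbrakk>f \<in> Hom C X Y; g \<in> Hom C Y Z\<rbrakk>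
        \<Longrightarrow> amap F (g \<cdot>\<^bsub>C\<^esub> f) = amap F g \<cdot>\<^bsub>D\<^esub> amap F f"

definition has_left_inverse :: "('o, 'm, 'x) category_scheme \<Rightarrow> 'm \<Rightarrow> bool" where
  "has_left_inverse D f \<longleftrightarrow>
    (\<exists>g \<in> Hom D (Cod D f) (Dom D f). g \<cdot>\<^bsub>D\<^esub> f = Id D (Dom D f))"

definition has_right_inverse :: "('o, 'm, 'x) category_scheme \<Rightarrow> 'm \<Rightarrow> bool" where
  "has_right_inverse D f \<longleftrightarrow>
    (\<exists>g \<in> Hom D (Cod D f) (Dom D f). f \<cdot>\<^bsub>D\<^esub> g = Id D (Cod D f))"

text \<open>
  In the definitions below, \<open>C\<close> is the common source of \<open>F\<close> and \<open>H\<close>, \<open>D\<close> is the target of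
  \<open>F\<close>, and \<open>E\<close> is the target of \<open>H\<close>.
\<close>

definition H_separable ::
  "('o1, 'm1, 'x1) category_scheme \<Rightarrow> ('o2, 'm2, 'x2) category_scheme \<Rightarrow>
   ('o3, 'm3, 'x3) category_scheme \<Rightarrow> ('o1, 'm1, 'o2, 'm2, 'y1) functor_map_scheme \<Rightarrow>
   ('o1, 'm1, 'o3, 'm3, 'y2) functor_map_scheme \<Rightarrow> bool" where
  "H_separable C D E F H \<longleftrightarrow>
    (\<exists>P :: 'o1 \<Rightarrow> 'o1 \<Rightarrow> 'm2 \<Rightarrow> 'm3.
      (\<forall>X \<in> Obj C. \<forall>Y \<in> Obj C. \<forall>h \<in> Hom D (omap F X) (omap F Y).
        P X Y h \<in> Hom E (omap H X) (omap H Y)) \<and>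
      (\<forall>X \<in> Obj C. \<forall>Y \<in> Obj C. \<forall>Z \<in> Obj C. \<forall>T \<in> Obj C.
        \<forall>u \<in> Hom C X Y. \<forall>v \<in> Hom C Z T. \<forall>h \<in> Hom D (omap F Y) (omap F Z).
          P X T (amap F v \<cdot>\<^bsub>D\<^esub> h \<cdot>\<^bsub>D\<^esub> amap F u) =
            amap H v \<cdot>\<^bsub>E\<^esub> P Y Z h \<cdot>\<^bsub>E\<^esub> amap H u) \<and>
      (\<forall>X \<in> Obj C. \<forall>Y \<in> Obj C. \<forall>f \<in> Hom C X Y. P X Y (amap F f) = amap H f))"

definition relative_injective ::
  "('o1, 'm1, 'x1) category_scheme \<Rightarrow> ('o2, 'm2, 'x2) category_scheme \<Rightarrow>
   ('o3, 'm3, 'x3) category_scheme \<Rightarrow> ('o1, 'm1, 'o2, 'm2, 'y1) functor_map_scheme \<Rightarrow>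
   ('o1, 'm1, 'o3, 'm3, 'y2) functor_map_scheme \<Rightarrow> 'o1 \<Rightarrow> bool" where
  "relative_injective C D E F H M \<longleftrightarrow>
    (\<forall>X \<in> Obj C. \<forall>X' \<in> Obj C. \<forall>i \<in> Hom C X X'. has_left_inverse D (amap F i) \<longrightarrow>
      (\<forall>f \<in> Hom C X M. \<exists>g \<in> Hom E (omap H X') (omap H M).
        amap H f = g \<cdot>\<^bsub>E\<^esub> amap H i))"

definition relative_projective ::
  "('o1, 'm1, 'x1) category_scheme \<Rightarrow> ('o2, 'm2, 'x2) category_scheme \<Rightarrow>
   ('o3, 'm3, 'x3) category_scheme \<Rightarrow> ('o1, 'm1, 'o2, 'm2, 'y1) functor_map_scheme \<Rightarrow>
   ('o1, 'm1, 'o3, 'm3, 'y2) functor_map_scheme \<Rightarrow> 'o1 \<Rightarrow> bool" where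
  "relative_projective C D E F H M \<longleftrightarrow>
    (\<forall>X \<in> Obj C. \<forall>X' \<in> Obj C. \<forall>p \<in> Hom C X' X. has_right_inverse D (amap F p) \<longrightarrow>
      (\<forall>f \<in> Hom C M X. \<exists>g \<in> Hom E (omap H M) (omap H X').
        amap H f = amap H p \<cdot>\<^bsub>E\<^esub> g))"

definition H_Maschke ::
  "('o1, 'm1, 'x1) category_scheme \<Rightarrow> ('o2, 'm2, 'x2) category_scheme \<Rightarrow>
   ('o3, 'm3, 'x3) category_scheme \<Rightarrow> ('o1, 'm1, 'o2, 'm2, 'y1) functor_map_scheme \<Rightarrow>
   ('o1, 'm1, 'o3, 'm3, 'y2) functor_map_scheme \<Rightarrow> bool" where
  "H_Maschke C D E F H \<longleftrightarrow> (\<forall>M \<in> Obj C. relative_injective C D E F H M)"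

definition dual_H_Maschke ::
  "('o1, 'm1, 'x1) category_scheme \<Rightarrow> ('o2, 'm2, 'x2) category_scheme \<Rightarrow>
   ('o3, 'm3, 'x3) category_scheme \<Rightarrow> ('o1, 'm1, 'o2, 'm2, 'y1) functor_map_scheme \<Rightarrow>
   ('o1, 'm1, 'o3, 'm3, 'y2) functor_map_scheme \<Rightarrow> bool" where
  "dual_H_Maschke C D E F H \<longleftrightarrow> (\<forall>P \<in> Obj C. relative_projective C D E F H P)"

end

theory Submission
  imports Defs
begin

text \<open>
  A natural family \<open>P\<close> with \<open>P (F f) = H f\<close> transports factorisations in \<open>D\<close> to
  factorisations in \<open>E\<close>. Suppose that \<open>F i\<close> has a left inverse \<open>j\<close>. There need not be any
  morphism of \<open>C\<close> that extends \<open>f : X \<rightarrow> M\<close> along \<open>i : X \<rightarrow> X'\<close>, but in \<open>D\<close> the morphism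
  \<open>F f \<cdot> j\<close> extends \<open>F f\<close> along \<open>F i\<close>, because \<open>(F f \<cdot> j) \<cdot> F i = F f\<close>. Applying \<open>P\<close> and
  moving \<open>i\<close> out of it by naturality gives \<open>P (F f \<cdot> j) \<cdot> H i = P (F f) = H f\<close>, so
  \<open>P (F f \<cdot> j)\<close> is the required extension of \<open>H f\<close>. Dually, if \<open>j\<close> is a right inverse of
  \<open>F p\<close>, then \<open>P (j \<cdot> F f)\<close> lifts \<open>H f\<close> along \<open>H p\<close>.

  Each half needs naturality in one variable only. Placing an identity on the other side of the
  two-sided naturality square yields these special cases, \<open>P_precomp\<close> and \<open>P_postcomp\<close>.
\<close>

locale separating_family = F: cat_functor C D F + H: cat_functor C E H
  for C :: "('o1, 'm1, 'x1) category_scheme" and D :: "('o2, 'm2, 'x2) category_scheme"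
    and E :: "('o3, 'm3, 'x3) category_scheme"
    and F :: "('o1, 'm1, 'o2, 'm2, 'y1) functor_map_scheme"
    and H :: "('o1, 'm1, 'o3, 'm3, 'y2) functor_map_scheme" +
  fixes P :: "'o1 \<Rightarrow> 'o1 \<Rightarrow> 'm2 \<Rightarrow> 'm3"
  assumes P_in_Hom: "\<lbrakk>X \<in> Obj C; Y \<in> Obj C; h \<in> Hom D (omap F X) (omap F Y)\<rbrakk>
      \<Longrightarrow> P X Y h \<in> Hom E (omap H X) (omap H Y)"
    and P_natural: "\<lbrakk>X \<in> Obj C; Y \<in> Obj C; Z \<in> Obj C; T \<in> Obj C;
        u \<in> Hom C X Y; v \<in> Hom C Z T; h \<in> Hom D (omap F Y) (omap F Z)\<rbrakk>
      \<Longrightarrow> P X T (amap F v \<cdot>\<^bsub>D\<^esub> h \<cdot>\<^bsub>D\<^esub> amap F u) =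
        amap H v \<cdot>\<^bsub>E\<^esub> P Y Z h \<cdot>\<^bsub>E\<^esub> amap H u"
    and P_amap: "\<lbrakk>X \<in> Obj C; Y \<in> Obj C; f \<in> Hom C X Y\<rbrakk> \<Longrightarrow> P X Y (amap F f) = amap H f"
begin

lemma P_precomp:
  assumes X: "X \<in> Obj C" and Y: "Y \<in> Obj C" and Z: "Z \<in> Obj C" and u: "u \<in> Hom C X Y"
    and h: "h \<in> Hom D (omap F Y) (omap F Z)"
  shows "P X Z (h \<cdot>\<^bsub>D\<^esub> amap F u) = P Y Z h \<cdot>\<^bsub>E\<^esub> amap H u"
proof -
  have hu: "h \<cdot>\<^bsub>D\<^esub> amap F u \<in> Hom D (omap F X) (omap F Z)"
    using F.amap_in_Hom[OF u] h by (rule F.target.comp_in_Hom)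
  have Pu: "P Y Z h \<cdot>\<^bsub>E\<^esub> amap H u \<in> Hom E (omap H X) (omap H Z)"
    using H.amap_in_Hom[OF u] P_in_Hom[OF Y Z h] by (rule H.target.comp_in_Hom)
  show ?thesis
    using P_natural[OF X Y Z Z u F.source.id_in_Hom[OF Z] h]
    by (simp add: F.amap_id[OF Z] H.amap_id[OF Z]
        F.target.comp_id_left[OF hu] H.target.comp_id_left[OF Pu])
qed

lemma P_postcomp:
  assumes Y: "Y \<in> Obj C" and Z: "Z \<in> Obj C" and T: "T \<in> Obj C" and v: "v \<in> Hom C Z T"
    and h: "h \<in> Hom D (omap F Y) (omap F Z)"
  shows "P Y T (amap F v \<cdot>\<^bsub>D\<^esub> h) = amap H v \<cdot>\<^bsub>E\<^esub> P Y Z h"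
  using P_natural[OF Y Y Z T F.source.id_in_Hom[OF Y] v h]
  by (simp add: F.amap_id[OF Y] H.amap_id[OF Y]
      F.target.comp_id_right[OF h] H.target.comp_id_right[OF P_in_Hom[OF Y Z h]])

text \<open>
  Extending \<open>amap F f\<close> along the split monomorphism \<open>amap F i\<close> is possible in \<open>D\<close>. Since \<open>i\<close>
  acts there by precomposition, naturality in the source is what carries the extension over
  to \<open>E\<close>.
\<close>

lemma H_Maschke: "H_Maschke C D E F H"
  unfolding H_Maschke_def relative_injective_def
proof (intro ballI impI)
  fix M X X' i f
  assume M: "M \<in> Obj C" and X: "X \<in> Obj C" and X': "X' \<in> Obj C"
    and i: "i \<in> Hom C X X'" and f: "f \<in> Hom C X M"
    and "has_left_inverse D (amap F i)"
  then obtain j where j: "j \<in> Hom D (omap F X') (omap F X)"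
    and ji: "j \<cdot>\<^bsub>D\<^esub> amap F i = Id D (omap F X)"
    using F.amap_in_Hom[OF i] unfolding has_left_inverse_def Hom_def by auto
  let ?h = "amap F f \<cdot>\<^bsub>D\<^esub> j"
  have h: "?h \<in> Hom D (omap F X') (omap F M)"
    using j F.amap_in_Hom[OF f] by (rule F.target.comp_in_Hom)
  have "?h \<cdot>\<^bsub>D\<^esub> amap F i = amap F f"
    by (simp add: F.target.comp_assoc[OF F.amap_in_Hom[OF i] j F.amap_in_Hom[OF f]] ji
        F.target.comp_id_right[OF F.amap_in_Hom[OF f]])
  then have "amap H f = P X' M ?h \<cdot>\<^bsub>E\<^esub> amap H i"
    using P_precomp[OF X X' M i h] P_amap[OF X M f] by simp
  then show "\<exists>g \<in> Hom E (omap H X') (omap H M). amap H f = g \<cdot>\<^bsub>E\<^esub> amap H i"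
    using P_in_Hom[OF X' M h] by blast
qed

text \<open>
  The same argument for a split epimorphism: \<open>p\<close> acts by postcomposition, so naturality in the
  target takes over.
\<close>

lemma dual_H_Maschke: "dual_H_Maschke C D E F H"
  unfolding dual_H_Maschke_def relative_projective_def
proof (intro ballI impI)
  fix M X X' p f
  assume M: "M \<in> Obj C" and X: "X \<in> Obj C" and X': "X' \<in> Obj C"
    and p: "p \<in> Hom C X' X" and f: "f \<in> Hom C M X"
    and "has_right_inverse D (amap F p)"
  then obtain j where j: "j \<in> Hom D (omap F X) (omap F X')"
    and pj: "amap F p \<cdot>\<^bsub>D\<^esub> j = Id D (omap F X)"
    using F.amap_in_Hom[OF p] unfolding has_right_inverse_def Hom_def by auto
  let ?h = "j \<cdot>\<^bsub>D\<^esub> amap F f"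
  have h: "?h \<in> Hom D (omap F M) (omap F X')"
    using F.amap_in_Hom[OF f] j by (rule F.target.comp_in_Hom)
  have "amap F p \<cdot>\<^bsub>D\<^esub> ?h = amap F f"
    by (simp add: F.target.comp_assoc[OF F.amap_in_Hom[OF f] j F.amap_in_Hom[OF p], symmetric]
        pj F.target.comp_id_left[OF F.amap_in_Hom[OF f]])
  then have "amap H f = amap H p \<cdot>\<^bsub>E\<^esub> P M X' ?h"
    using P_postcomp[OF M X' X p h] P_amap[OF M X f] by simp
  then show "\<exists>g \<in> Hom E (omap H M) (omap H X'). amap H f = amap H p \<cdot>\<^bsub>E\<^esub> g"
    using P_in_Hom[OF M X' h] by blast
qed

end

theorem proposition4p3:
  fixes C :: "('o1, 'm1) category" and D :: "('o2, 'm2) category" and E :: "('o3, 'm3) category"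
    and F :: "('o1, 'm1, 'o2, 'm2) functor_map" and H :: "('o1, 'm1, 'o3, 'm3) functor_map"
  assumes "cat_functor C D F"
    and "cat_functor C E H"
    and "H_separable C D E F H"
  shows "H_Maschke C D E F H \<and> dual_H_Maschke C D E F H"
proof -
  from assms(3) have "\<exists>P. separating_family_axioms C D E F H P"
    unfolding H_separable_def separating_family_axioms_def by (elim ex_forward) simp
  then obtain P where "separating_family_axioms C D E F H P" ..
  with assms(1,2) interpret separating_family C D E F H P
    by (rule separating_family.intro)
  show ?thesis
    using H_Maschke dual_H_Maschke ..
qed

end
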